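(* Let $\mathcal C$ be a fixed partition of $\mathcal M=\{1,\dots,M\}$ into coalitions. Suppose that: each pair $(A_{ii},B_i)$, $i\in\mathcal M$, is controllable; each $\mathbb X_i\subset\mathbb R^{n_i}$ and $\mathbb U_i\subset\mathbb R^{m_i}$ is compact and convex with the origin in its interior; for every partition of $\mathcal M$, the pair $(A_{cc},B_c)$ of each of its coalitions $c$ is controllable; all $Q_i$, $R_i$ are positive definite; for each $c\in\mathcal C$ the control law $\hat f_c=\tilde\kappa_c(\hat e_c)$ is invariance inducing over a set $\mathcal R_c$ that is robust control invariant for $\hat e_c^+=A_{cc}\hat e_c+B_c\hat f_c+\hat w_c$ and the constraint set $(\xi_c^x\mathbb X_c,\xi_c^u\mathbb U_c,\hat{\mathbb W}_c)$ for some $\xi_c^x,\xi_c^u\in[0,1)$, where $\hat{\mathbb W}_c=\bigoplus_{d\in\mathcal M_c}(1-\alpha_d^x)A_{cd}\mathbb X_d$; and for each $c\in\mathcal C$, $\alpha_c^x+\beta_c^x+\xi_c^x\le1$ and $\alpha_c^u+\beta_c^u+\xi_c^u\le1$. Then, for each coalition $c\in\mathcal C$: (i) If $\bar x_c\in\bar{\mathcal X}_c^N$ then $A_{cc}\bar x_c+B_c\bar\kappa_c(\bar x_c)\in\bar{\mathcal X}_c^N$. (ii) If $\bar e_c\in\bar{\mathcal E}_c^H(\bar{\mathbf w}_c)$ for some $\bar{\mathbf w}_c\in\bar{\mathcal W}_c^N$, then $A_{cc}\bar e_c+B_c\hat\kappa_c(\bar e_c;\bar{\mathbf w}_c)+\bar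 w_c\in\bar{\mathcal E}_c^H(\bar{\mathbf w}_c^+)$, where $\bar w_c=\bar{\mathbf w}_c(0)$ is the first element of $\bar{\mathbf w}_c$. (iii) If $\bar x_c(0)=x_c(0)\in\bar{\mathcal X}_c^N$, then the coalition dynamics $x_c^+=A_{cc}x_c+B_cu_c+w_c$ under the control law $u_c=\bar\kappa_c(\bar x_c)+\hat\kappa_c(\bar e_c;\bar{\mathbf w}_c)+\tilde\kappa_c(\hat e_c)$ (applied as in the coalitional MPC algorithm) satisfy $x_c(k)\in\mathbb X_c$ and $u_c(k)\in\mathbb U_c$ for all integers $k\ge0$.
   Context: System: $x^+=Ax+Bu$, $x=(x_1,\dots,x_M)$, $u=(u_1,\dots,u_M)$, $x_i\in\mathbb R^{n_i}$, $u_i\in\mathbb R^{m_i}$; subsystem $i\in\mathcal M=\{1,\dots,M\}$ has dynamics $x_i^+=A_{ii}x_i+B_iu_i+\sum_{j\neq i}A_{ij}x_j$, constraints $x_i\in\mathbb X_i$, $u_i\in\mathbb U_i$, and cost matrices $Q_i,R_i$. A coalition is a nonempty subset of $\mathcal M$; a partition $\mathcal C$ is a set of pairwise disjoint coalitions covering $\mathcal M$. For $c\in\mathcal C$: $x_c=(x_i)_{i\in c}$, $u_c=(u_i)_{i\in c}$, $A_{cc}=[A_{ij}]_{i,j\in c}$, $B_c=\mathrm{diag}(B_i)_{i\in c}$, $A_{cd}=[A_{ij}]_{i\in c,j\in d}$, $\mathcal M_c=\{d\in\mathcal C\setminus\{c\}:A_{cd}\neq0\}$, $\mathbb X_c=\prod_{i\in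 c}\mathbb X_i$, $\mathbb U_c=\prod_{i\in c}\mathbb U_i$, $Q_c=\mathrm{diag}(Q_i)_{i\in c}$, $R_c=\mathrm{diag}(R_i)_{i\in c}$. Coalition dynamics: $x_c^+=A_{cc}x_c+B_cu_c+w_c$, $w_c=\sum_{d\in\mathcal M_c}A_{cd}x_d$. Robust control invariance: $\mathcal R$ is robust control invariant (RCI) for $x^+=f(x,u,w)$ and $(\mathbb X,\mathbb U,\mathbb W)$ if $\mathcal R\subset\mathbb X$ and for all $x\in\mathcal R$ there is $u=\mu(x)\in\mathbb U$ with $f(x,u,w)\in\mathcal R$ for all $w\in\mathbb W$; such $\mu$ is called invariance inducing over $\mathcal R$. $\oplus$ is the Minkowski sum. Primary problem $\bar{\mathbb P}_c(\bar x_c)$ (horizon $N$): minimize $\sum_{j=0}^{N-1}\bar x_c(j)^\top Q_c\bar x_c(j)+\bar u_c(j)^\top R_c\bar u_c(j)$ over $\bar{\mathbf u}_c=\{\bar u_c(0),\dots,\bar u_c(N-1)\}$ subject to $\bar x_c(0)=\bar x_c$, $\bar x_c(j+1)=A_{cc}\bar x_c(j)+B_c\bar u_c(j)$, $\bar x_c(j)\in\alpha_c^x\mathbb X_c$, $\bar u_c(j)\in\alpha_c^u\mathbb U_c$ for $j=0,\dots,N-1$, and $\bar x_c(N)=0$. Here $\alpha_c^x,\alpha_c^u\in(0,1)$. $\bar{\mathcal X}_c^N$ is the set of $\bar x_c$ for which it is feasible; $\bar{\mathbf u}_c^0,\bar{\mathbf x}_c^0$ are the optimal input and state sequences, and $\bar\kappa_c(\bar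 x_c)=\bar u_c^0(0;\bar x_c)$. Secondary problem $\hat{\mathbb P}_c(\bar e_c;\bar{\mathbf w}_c)$ (horizon $H\ge N+1$), for a disturbance sequence $\bar{\mathbf w}_c=\{\bar w_c(0),\dots,\bar w_c(N)\}$ (with $\bar w_c(j)=0$ for later $j$): minimize $\sum_{j=0}^{H-1}\bar e_c(j)^\top Q_c\bar e_c(j)+\bar f_c(j)^\top R_c\bar f_c(j)$ over $\bar{\mathbf f}_c=\{\bar f_c(0),\dots,\bar f_c(H-1)\}$ subject to $\bar e_c(0)=\bar e_c$, $\bar e_c(j+1)=A_{cc}\bar e_c(j)+B_c\bar f_c(j)+\bar w_c(j)$, $\bar e_c(j)\in\beta_c^x\mathbb X_c$, $\bar f_c(j)\in\beta_c^u\mathbb U_c$ for $j=0,\dots,H-1$, and $\bar e_c(H)=0$. $\bar{\mathcal E}_c^H(\bar{\mathbf w}_c)$ is the set of $\bar e_c$ for which it is feasible; $\hat V_c^0$ is its optimal value, $\bar{\mathbf f}_c^0$ its solution, and $\hat\kappa_c(\bar e_c;\bar{\mathbf w}_c)=\bar f_c^0(0;\bar e_c,\bar{\mathbf w}_c)$. $\bar{\mathbb W}_c=\bigoplus_{d\in\mathcal M_c}\alpha_d^xA_{cd}\mathbb X_d$; $\bar{\mathcal W}_c^N=\bar{\mathbb W}_c\times\dots\times\bar{\mathbb W}_c\times\{0\}$ ($N$ copies of $\bar{\mathbb W}_c$). For $\bar{\mathbf w}_c=\{\bar w_c(0),\dots,\bar w_c(N-1),0\}\in\bar{\mathcal W}_c^N$,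 $\bar{\mathbf w}_c^+=\{\bar w_c(1),\dots,\bar w_c(N-1),0,0\}$. Coalitional MPC algorithm (run in parallel by all coalitions of $\mathcal C$). Initialize $\bar x_c=x_c(0)$, $\bar e_c=0$, $\bar{\mathbf w}_c=\mathbf 0$, $\hat V_c=+\infty$. At each time step: (1) solve $\bar{\mathbb P}_c(\bar x_c)$ for $\bar{\mathbf u}_c^0,\bar{\mathbf x}_c^0$; (2) exchange the sequences $\bar{\mathbf x}^0$ with neighbours and set $\bar{\mathbf w}_c^0=\sum_{d\in\mathcal M_c}A_{cd}\bar{\mathbf x}_d^0$; (3) if $\hat{\mathbb P}_c(\bar e_c;\bar{\mathbf w}_c^0)$ is feasible with optimal value $\le\hat V_c$, set $\bar{\mathbf w}_c=\bar{\mathbf w}_c^0$ and $\hat V_c$ equal to that value, otherwise solve $\hat{\mathbb P}_c(\bar e_c;\bar{\mathbf w}_c)$; let $\bar{\mathbf f}_c^0$ be the solution; (4) measure $x_c$, set $\hat e_c=x_c-\bar x_c-\bar e_c$ and apply $u_c=\bar u_c^0(0)+\bar f_c^0(0)+\tilde\kappa_c(\hat e_c)$; (5) update $\bar x_c^+=A_{cc}\bar x_c+B_c\bar u_c^0(0)$, $\bar e_c^+=A_{cc}\bar e_c+B_c\bar f_c^0(0)+\bar w_c(0)$, $\bar{\mathbf w}_c^+=\{\bar w_c(1),\dots,\bar w_c(N),0\}$, $\hat V_c^+=\hat V_c-[\bar e_c^\top Q_c\bar e_c+\bar f_c^0(0)^\top R_c\bar f_c^0(0)]$; (6) go to the next time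 step.
   Formalization: Part (iii) is false as stated; it is proved with scalings β ≥ 0 and two added assumptions: 0 lies in every R_c, and whenever the algorithm keeps its stored disturbance sequence, the actual coupling w_c minus that sequence's first element lies in Ŵ_c. *)

theory Defs
  imports "HOL-Analysis.Analysis" "HOL-Library.Set_Algebras" "HOL-Library.Disjoint_Sets"
    "HOL-Library.Extended_Real"
begin

section \<open>Interconnected plants\<close>

text \<open>
  The subsystems are the elements of a finite type \<open>'s\<close>. The coordinates of the overall state
  and input are the finite types \<open>'n\<close> and \<open>'m\<close>; \<open>st_of\<close> and \<open>in_of\<close> say which subsystem a
  coordinate belongs to. Thus the state space of subsystem \<open>i\<close>, of dimension \<open>card {k. st_of k = i}\<close>,
  is the coordinate subspace \<open>csub st_of {i}\<close> of \<open>real ^ 'n\<close>, and a coalition vector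
  \<open>(x\<^sub>i)\<close> with \<open>i\<close> in \<open>c\<close> is an element of \<open>csub st_of c\<close>. A block matrix such as \<open>A\<^sub>i\<^sub>j\<close> is a
  full-size matrix vanishing outside rows \<open>i\<close> and columns \<open>j\<close>, so that assembling blocks is addition.
\<close>

definition csub :: "('k \<Rightarrow> 's) \<Rightarrow> 's set \<Rightarrow> (real ^ 'k::finite) set" where
  "csub own c = {x. \<forall>k. own k \<notin> c \<longrightarrow> x $ k = 0}"

definition restr :: "('k \<Rightarrow> 's) \<Rightarrow> 's set \<Rightarrow> real ^ 'k \<Rightarrow> real ^ 'k::finite" where
  "restr own c x = (\<chi> k. if own k \<in> c then x $ k else 0)"

definition supported :: "('k \<Rightarrow> 's) \<Rightarrow> ('l \<Rightarrow> 's) \<Rightarrow> 's \<Rightarrow> 's \<Rightarrow> real ^ 'l::finite ^ 'k::finite \<Rightarrow> bool" where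
  "supported own own' i j G \<longleftrightarrow> (\<forall>k l. G $ k $ l \<noteq> 0 \<longrightarrow> own k = i \<and> own' l = j)"

record ('s, 'n::finite, 'm::finite) plant =
  st_of :: "'n \<Rightarrow> 's"
  in_of :: "'m \<Rightarrow> 's"
  Ablk :: "'s \<Rightarrow> 's \<Rightarrow> real ^ 'n ^ 'n"
  Bblk :: "'s \<Rightarrow> real ^ 'm ^ 'n"
  Xsub :: "'s \<Rightarrow> (real ^ 'n) set"
  Usub :: "'s \<Rightarrow> (real ^ 'm) set"
  Qsub :: "'s \<Rightarrow> real ^ 'n ^ 'n"
  Rsub :: "'s \<Rightarrow> real ^ 'm ^ 'm"

definition wf_plant :: "('s, 'n::finite, 'm::finite) plant \<Rightarrow> bool" where
  "wf_plant P \<longleftrightarrow>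
     (\<forall>i j. supported (st_of P) (st_of P) i j (Ablk P i j)) \<and>
     (\<forall>i. supported (st_of P) (in_of P) i i (Bblk P i)) \<and>
     (\<forall>i. supported (st_of P) (st_of P) i i (Qsub P i)) \<and>
     (\<forall>i. supported (in_of P) (in_of P) i i (Rsub P i)) \<and>
     (\<forall>i. Xsub P i \<subseteq> csub (st_of P) {i}) \<and>
     (\<forall>i. Usub P i \<subseteq> csub (in_of P) {i})"

abbreviation xspace :: "('s, 'n::finite, 'm::finite) plant \<Rightarrow> 's set \<Rightarrow> (real ^ 'n) set" where
  "xspace P c \<equiv> csub (st_of P) c"

abbreviation uspace :: "('s, 'n::finite, 'm::finite) plant \<Rightarrow> 's set \<Rightarrow> (real ^ 'm) set" where
  "uspace P c \<equiv> csub (in_of P) c"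

definition Ac :: "('s, 'n::finite, 'm::finite) plant \<Rightarrow> 's set \<Rightarrow> 's set \<Rightarrow> real ^ 'n ^ 'n" where
  "Ac P c d = (\<Sum>i\<in>c. \<Sum>j\<in>d. Ablk P i j)"

definition Bc :: "('s, 'n::finite, 'm::finite) plant \<Rightarrow> 's set \<Rightarrow> real ^ 'm ^ 'n" where
  "Bc P c = (\<Sum>i\<in>c. Bblk P i)"

definition Qc :: "('s, 'n::finite, 'm::finite) plant \<Rightarrow> 's set \<Rightarrow> real ^ 'n ^ 'n" where
  "Qc P c = (\<Sum>i\<in>c. Qsub P i)"

definition Rc :: "('s, 'n::finite, 'm::finite) plant \<Rightarrow> 's set \<Rightarrow> real ^ 'm ^ 'm" where
  "Rc P c = (\<Sum>i\<in>c. Rsub P i)"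

definition Xc :: "('s, 'n::finite, 'm::finite) plant \<Rightarrow> 's set \<Rightarrow> (real ^ 'n) set" where
  "Xc P c = {x \<in> xspace P c. \<forall>i\<in>c. restr (st_of P) {i} x \<in> Xsub P i}"

definition Uc :: "('s, 'n::finite, 'm::finite) plant \<Rightarrow> 's set \<Rightarrow> (real ^ 'm) set" where
  "Uc P c = {u \<in> uspace P c. \<forall>i\<in>c. restr (in_of P) {i} u \<in> Usub P i}"

definition nbrs :: "('s, 'n::finite, 'm::finite) plant \<Rightarrow> 's set set \<Rightarrow> 's set \<Rightarrow> 's set set" where
  "nbrs P C c = {d \<in> C - {c}. Ac P c d \<noteq> 0}"

abbreviation scaled :: "real \<Rightarrow> 'a::real_vector set \<Rightarrow> 'a set" where
  "scaled a S \<equiv> (\<lambda>x. a *\<^sub>R x) ` S"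

text \<open>In the next definition \<open>\<Sum>\<close> over sets is the Minkowski sum (the empty sum being \<open>{0}\<close>).\<close>

definition coupling_set ::
  "('s, 'n::finite, 'm::finite) plant \<Rightarrow> 's set set \<Rightarrow> ('s set \<Rightarrow> real) \<Rightarrow> 's set \<Rightarrow> (real ^ 'n) set" where
  "coupling_set P C a c = (\<Sum>d\<in>nbrs P C c. scaled (a d) ((*v) (Ac P c d) ` Xc P d))"

section \<open>System-theoretic notions\<close>

primrec traj :: "real ^ 'n ^ 'n \<Rightarrow> real ^ 'm ^ 'n \<Rightarrow> (nat \<Rightarrow> real ^ 'n) \<Rightarrow> real ^ 'n \<Rightarrow>
    (nat \<Rightarrow> real ^ 'm) \<Rightarrow> nat \<Rightarrow> real ^ 'n::finite" where
  "traj A B w x u 0 = x"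
| "traj A B w x u (Suc j) = A *v traj A B w x u j + B *v u j + w j"

definition controllable :: "(real ^ 'n) set \<Rightarrow> (real ^ 'm) set \<Rightarrow>
    real ^ 'n::finite ^ 'n \<Rightarrow> real ^ 'm::finite ^ 'n \<Rightarrow> bool" where
  "controllable S V A B \<longleftrightarrow>
     (\<forall>x\<in>S. \<forall>y\<in>S. \<exists>T u. (\<forall>j. u j \<in> V) \<and> traj A B (\<lambda>_. 0) x u T = y)"

definition posdef_on :: "(real ^ 'k) set \<Rightarrow> real ^ 'k::finite ^ 'k \<Rightarrow> bool" where
  "posdef_on S G \<longleftrightarrow> (\<forall>x\<in>S. x \<noteq> 0 \<longrightarrow> x \<bullet> (G *v x) > 0)"

definition rci :: "('x \<Rightarrow> 'u \<Rightarrow> 'w \<Rightarrow> 'x) \<Rightarrow> 'x set \<Rightarrow> 'u set \<Rightarrow> 'w set \<Rightarrow> 'x set \<Rightarrow> bool" where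
  "rci f X U W S \<longleftrightarrow> S \<subseteq> X \<and> (\<forall>x\<in>S. \<exists>u\<in>U. \<forall>w\<in>W. f x u w \<in> S)"

definition invariance_inducing ::
  "('x \<Rightarrow> 'u \<Rightarrow> 'w \<Rightarrow> 'x) \<Rightarrow> 'u set \<Rightarrow> 'w set \<Rightarrow> ('x \<Rightarrow> 'u) \<Rightarrow> 'x set \<Rightarrow> bool" where
  "invariance_inducing f U W \<mu> S \<longleftrightarrow> (\<forall>x\<in>S. \<mu> x \<in> U \<and> (\<forall>w\<in>W. f x (\<mu> x) w \<in> S))"

definition stage_cost :: "('s, 'n::finite, 'm::finite) plant \<Rightarrow> 's set \<Rightarrow> real ^ 'n \<Rightarrow> real ^ 'm \<Rightarrow> real" where
  "stage_cost P c x u = x \<bullet> (Qc P c *v x) + u \<bullet> (Rc P c *v u)"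

section \<open>The optimal control problems\<close>

record 's tuning =
  N :: nat
  H :: nat
  \<alpha>x :: "'s set \<Rightarrow> real"
  \<alpha>u :: "'s set \<Rightarrow> real"
  \<beta>x :: "'s set \<Rightarrow> real"
  \<beta>u :: "'s set \<Rightarrow> real"

text \<open>
  Finite sequences are functions on \<open>nat\<close> that are \<open>0\<close> past their last index.
  For a nonempty feasible set, \<open>arg_min_on\<close> picks an optimal solution.
\<close>

abbreviation xbar :: "('s, 'n::finite, 'm::finite) plant \<Rightarrow> 's set \<Rightarrow> real ^ 'n \<Rightarrow>
    (nat \<Rightarrow> real ^ 'm) \<Rightarrow> nat \<Rightarrow> real ^ 'n" where
  "xbar P c \<equiv> traj (Ac P c c) (Bc P c) (\<lambda>_. 0)"

abbreviation ebar :: "('s, 'n::finite, 'm::finite) plant \<Rightarrow> 's set \<Rightarrow> (nat \<Rightarrow> real ^ 'n) \<Rightarrow> real ^ 'n \<Rightarrow>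
    (nat \<Rightarrow> real ^ 'm) \<Rightarrow> nat \<Rightarrow> real ^ 'n" where
  "ebar P c \<equiv> traj (Ac P c c) (Bc P c)"

definition feas1 :: "('s, 'n::finite, 'm::finite) plant \<Rightarrow> 's tuning \<Rightarrow> 's set \<Rightarrow> real ^ 'n \<Rightarrow>
    (nat \<Rightarrow> real ^ 'm) set" where
  "feas1 P T c x = {u. (\<forall>j\<ge>N T. u j = 0) \<and>
     (\<forall>j<N T. xbar P c x u j \<in> scaled (\<alpha>x T c) (Xc P c) \<and> u j \<in> scaled (\<alpha>u T c) (Uc P c)) \<and>
     xbar P c x u (N T) = 0}"

definition cost1 :: "('s, 'n::finite, 'm::finite) plant \<Rightarrow> 's tuning \<Rightarrow> 's set \<Rightarrow> real ^ 'n \<Rightarrow>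
    (nat \<Rightarrow> real ^ 'm) \<Rightarrow> real" where
  "cost1 P T c x u = (\<Sum>j<N T. stage_cost P c (xbar P c x u j) (u j))"

definition XN :: "('s, 'n::finite, 'm::finite) plant \<Rightarrow> 's tuning \<Rightarrow> 's set \<Rightarrow> (real ^ 'n) set" where
  "XN P T c = {x. feas1 P T c x \<noteq> {}}"

definition u_opt :: "('s, 'n::finite, 'm::finite) plant \<Rightarrow> 's tuning \<Rightarrow> 's set \<Rightarrow> real ^ 'n \<Rightarrow>
    nat \<Rightarrow> real ^ 'm" where
  "u_opt P T c x = arg_min_on (cost1 P T c x) (feas1 P T c x)"

definition x_opt :: "('s, 'n::finite, 'm::finite) plant \<Rightarrow> 's tuning \<Rightarrow> 's set \<Rightarrow> real ^ 'n \<Rightarrow>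
    nat \<Rightarrow> real ^ 'n" where
  "x_opt P T c x = xbar P c x (u_opt P T c x)"

definition \<kappa>bar :: "('s, 'n::finite, 'm::finite) plant \<Rightarrow> 's tuning \<Rightarrow> 's set \<Rightarrow> real ^ 'n \<Rightarrow> real ^ 'm" where
  "\<kappa>bar P T c x = u_opt P T c x 0"

definition feas2 :: "('s, 'n::finite, 'm::finite) plant \<Rightarrow> 's tuning \<Rightarrow> 's set \<Rightarrow> (nat \<Rightarrow> real ^ 'n) \<Rightarrow>
    real ^ 'n \<Rightarrow> (nat \<Rightarrow> real ^ 'm) set" where
  "feas2 P T c w e = {f. (\<forall>j\<ge>H T. f j = 0) \<and>
     (\<forall>j<H T. ebar P c w e f j \<in> scaled (\<beta>x T c) (Xc P c) \<and> f j \<in> scaled (\<beta>u T c) (Uc P c)) \<and>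
     ebar P c w e f (H T) = 0}"

definition cost2 :: "('s, 'n::finite, 'm::finite) plant \<Rightarrow> 's tuning \<Rightarrow> 's set \<Rightarrow> (nat \<Rightarrow> real ^ 'n) \<Rightarrow>
    real ^ 'n \<Rightarrow> (nat \<Rightarrow> real ^ 'm) \<Rightarrow> real" where
  "cost2 P T c w e f = (\<Sum>j<H T. stage_cost P c (ebar P c w e f j) (f j))"

definition EH :: "('s, 'n::finite, 'm::finite) plant \<Rightarrow> 's tuning \<Rightarrow> 's set \<Rightarrow> (nat \<Rightarrow> real ^ 'n) \<Rightarrow>
    (real ^ 'n) set" where
  "EH P T c w = {e. feas2 P T c w e \<noteq> {}}"

definition f_opt :: "('s, 'n::finite, 'm::finite) plant \<Rightarrow> 's tuning \<Rightarrow> 's set \<Rightarrow> (nat \<Rightarrow> real ^ 'n) \<Rightarrow>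
    real ^ 'n \<Rightarrow> nat \<Rightarrow> real ^ 'm" where
  "f_opt P T c w e = arg_min_on (cost2 P T c w e) (feas2 P T c w e)"

definition V_opt :: "('s, 'n::finite, 'm::finite) plant \<Rightarrow> 's tuning \<Rightarrow> 's set \<Rightarrow> (nat \<Rightarrow> real ^ 'n) \<Rightarrow>
    real ^ 'n \<Rightarrow> real" where
  "V_opt P T c w e = cost2 P T c w e (f_opt P T c w e)"

definition \<kappa>hat :: "('s, 'n::finite, 'm::finite) plant \<Rightarrow> 's tuning \<Rightarrow> 's set \<Rightarrow> (nat \<Rightarrow> real ^ 'n) \<Rightarrow>
    real ^ 'n \<Rightarrow> real ^ 'm" where
  "\<kappa>hat P T c w e = f_opt P T c w e 0"

definition Wbar :: "('s, 'n::finite, 'm::finite) plant \<Rightarrow> 's tuning \<Rightarrow> 's set set \<Rightarrow> 's set \<Rightarrow>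
    (real ^ 'n) set" where
  "Wbar P T C c = coupling_set P C (\<alpha>x T) c"

definition What :: "('s, 'n::finite, 'm::finite) plant \<Rightarrow> 's tuning \<Rightarrow> 's set set \<Rightarrow> 's set \<Rightarrow>
    (real ^ 'n) set" where
  "What P T C c = coupling_set P C (\<lambda>d. 1 - \<alpha>x T d) c"

definition WN :: "('s, 'n::finite, 'm::finite) plant \<Rightarrow> 's tuning \<Rightarrow> 's set set \<Rightarrow> 's set \<Rightarrow>
    (nat \<Rightarrow> real ^ 'n) set" where
  "WN P T C c = {w. (\<forall>j<N T. w j \<in> Wbar P T C c) \<and> (\<forall>j\<ge>N T. w j = 0)}"

definition shift :: "(nat \<Rightarrow> 'a) \<Rightarrow> nat \<Rightarrow> 'a" where
  "shift w = (\<lambda>j. w (Suc j))"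

section \<open>The coalitional MPC algorithm\<close>

text \<open>
  The local variables of a coalition at the beginning of a time step, together with the actual
  coalition state \<open>px\<close>.
\<close>

record ('n::finite) cstate =
  px :: "real ^ 'n"
  xb :: "real ^ 'n"
  eb :: "real ^ 'n"
  wb :: "nat \<Rightarrow> real ^ 'n"
  Vh :: ereal

context
  fixes P :: "('s, 'n::finite, 'm::finite) plant"
    and T :: "'s tuning"
    and C :: "'s set set"
    and \<kappa>t :: "'s set \<Rightarrow> real ^ 'n \<Rightarrow> real ^ 'm"
begin

definition w_new :: "('s set \<Rightarrow> 'n cstate) \<Rightarrow> 's set \<Rightarrow> nat \<Rightarrow> real ^ 'n" where
  "w_new s c j = (if j \<le> N T then \<Sum>d\<in>nbrs P C c. Ac P c d *v x_opt P T d (xb (s d)) j else 0)"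

definition accepts :: "('s set \<Rightarrow> 'n cstate) \<Rightarrow> 's set \<Rightarrow> bool" where
  "accepts s c \<longleftrightarrow> eb (s c) \<in> EH P T c (w_new s c) \<and>
     ereal (V_opt P T c (w_new s c) (eb (s c))) \<le> Vh (s c)"

definition w_used :: "('s set \<Rightarrow> 'n cstate) \<Rightarrow> 's set \<Rightarrow> nat \<Rightarrow> real ^ 'n" where
  "w_used s c = (if accepts s c then w_new s c else wb (s c))"

definition V_used :: "('s set \<Rightarrow> 'n cstate) \<Rightarrow> 's set \<Rightarrow> ereal" where
  "V_used s c = (if accepts s c then ereal (V_opt P T c (w_new s c) (eb (s c))) else Vh (s c))"

definition e_hat :: "('s set \<Rightarrow> 'n cstate) \<Rightarrow> 's set \<Rightarrow> real ^ 'n" where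
  "e_hat s c = px (s c) - xb (s c) - eb (s c)"

definition u_applied :: "('s set \<Rightarrow> 'n cstate) \<Rightarrow> 's set \<Rightarrow> real ^ 'm" where
  "u_applied s c =
     \<kappa>bar P T c (xb (s c)) + \<kappa>hat P T c (w_used s c) (eb (s c)) + \<kappa>t c (e_hat s c)"

definition w_actual :: "('s set \<Rightarrow> 'n cstate) \<Rightarrow> 's set \<Rightarrow> real ^ 'n" where
  "w_actual s c = (\<Sum>d\<in>nbrs P C c. Ac P c d *v px (s d))"

definition mpc_step :: "('s set \<Rightarrow> 'n cstate) \<Rightarrow> 's set \<Rightarrow> 'n cstate" where
  "mpc_step s c =
     \<lparr> px = Ac P c c *v px (s c) + Bc P c *v u_applied s c + w_actual s c,
       xb = Ac P c c *v xb (s c) + Bc P c *v \<kappa>bar P T c (xb (s c)),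
       eb = Ac P c c *v eb (s c) + Bc P c *v \<kappa>hat P T c (w_used s c) (eb (s c)) + w_used s c 0,
       wb = shift (w_used s c),
       Vh = V_used s c
              - ereal (stage_cost P c (eb (s c)) (\<kappa>hat P T c (w_used s c) (eb (s c)))) \<rparr>"

definition mpc_init :: "real ^ 'n \<Rightarrow> 's set \<Rightarrow> 'n cstate" where
  "mpc_init x0 c =
     \<lparr> px = restr (st_of P) c x0, xb = restr (st_of P) c x0, eb = 0, wb = (\<lambda>_. 0), Vh = \<infinity> \<rparr>"

primrec mpc_run :: "real ^ 'n \<Rightarrow> nat \<Rightarrow> 's set \<Rightarrow> 'n cstate" where
  "mpc_run x0 0 = mpc_init x0"
| "mpc_run x0 (Suc k) = mpc_step (mpc_run x0 k)"

text \<open>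
  The mismatch between the actual coupling disturbance and the one planned for is bounded by
  \<open>What\<close> by design when the freshly exchanged predictions are adopted. When the algorithm keeps its
  old sequence, the first entry of that sequence need not be the current coupling of the nominal
  states, and nothing in the algorithm bounds the mismatch; constraint satisfaction can
  then fail (two scalar integrators with coupling \<open>1/2\<close>, states in \<open>[-1,1]\<close>, \<open>\<alpha>x = 0.9\<close> and
  small \<open>\<beta>\<close>, where the initial zero plan is kept). This predicate says that the mismatch lies
  in \<open>What\<close> at such times as well.
\<close>

definition retained_plans_consistent :: "real ^ 'n \<Rightarrow> bool" where
  "retained_plans_consistent x0 \<longleftrightarrow>
     (\<forall>k. \<forall>c\<in>C. \<not> accepts (mpc_run x0 k) c \<longrightarrow>
        w_actual (mpc_run x0 k) c - wb (mpc_run x0 k c) 0 \<in> What P T C c)"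

end

end

theory Submission
  imports Defs
begin

text \<open>
  Shifting an optimal input sequence by one step and appending the zero input keeps it feasible,
  because the terminal state is the origin and, as \<open>N + 1 \<le> H\<close>, the disturbance has died out
  by then. This gives recursive feasibility of both problems once optimal sequences exist, which holds
  since the feasible sets are compact and the costs continuous in the product topology. Along a run
  the state of a coalition is the sum of the nominal state, the planned error and the residual
  error, which lie in \<open>\<alpha>X\<close>, \<open>\<beta>X\<close> and \<open>\<xi>X\<close>; convexity of \<open>X\<close> gives
  \<open>\<alpha>X + \<beta>X + \<xi>X \<subseteq> X\<close>, and also that the deviation from the nominal state lies in
  \<open>(1 - \<alpha>)X\<close>, which is what keeps the residual disturbance of the neighbours inside the set for
  which the residual error set is invariant.
\<close>

section \<open>Coordinate subspaces and constraint sets\<close>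

lemma restr_nth: "restr own c x $ k = (if own k \<in> c then x $ k else 0)"
  by (simp add: restr_def)

lemma linear_restr: "linear (restr own c)"
  by (rule linearI) (simp_all add: vec_eq_iff restr_nth)

lemma csub_subspace: "subspace (csub own c)"
  by (auto simp: subspace_def csub_def)

text \<open>Common form of \<open>Xc\<close> and \<open>Uc\<close>, so that convexity and
  compactness are shown once for states and inputs.\<close>

definition coalition_box ::
  "('k \<Rightarrow> 's) \<Rightarrow> ('s \<Rightarrow> (real ^ 'k::finite) set) \<Rightarrow> 's set \<Rightarrow> (real ^ 'k) set" where
  "coalition_box own S c = {x \<in> csub own c. \<forall>i\<in>c. restr own {i} x \<in> S i}"

lemma Xc_eq_coalition_box: "Xc P c = coalition_box (st_of P) (Xsub P) c"
  by (simp add: Xc_def coalition_box_def)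

lemma Uc_eq_coalition_box: "Uc P c = coalition_box (in_of P) (Usub P) c"
  by (simp add: Uc_def coalition_box_def)

lemma coalition_box_alt:
  "coalition_box own S c = csub own c \<inter> (\<Inter>i\<in>c. restr own {i} -` S i)"
  by (auto simp: coalition_box_def)

lemma zero_in_coalition_box:
  assumes "\<And>i. 0 \<in> S i"
  shows "0 \<in> coalition_box own S c"
  using assms by (simp add: coalition_box_def csub_def linear_0[OF linear_restr])

lemma convex_coalition_box:
  assumes "\<And>i. convex (S i)"
  shows "convex (coalition_box own S c)"
  unfolding coalition_box_alt
  by (intro convex_Int convex_INT subspace_imp_convex csub_subspace
      convex_linear_vimage linear_restr assms)

text \<open>Linear preimages of compact sets are closed but may be unbounded. Boundedness comes from
  the coordinates: each is bounded through the set of its own subsystem or vanishes outside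
  \<open>c\<close>.\<close>

lemma compact_coalition_box:
  assumes "\<And>i. compact (S i)"
  shows "compact (coalition_box own S c)"
proof -
  have "\<exists>b. \<forall>x\<in>S (own k). \<bar>x $ k\<bar> \<le> b" for k
    using compact_imp_bounded[OF assms[of "own k"]] component_le_norm_cart order_trans
    unfolding bounded_iff by blast
  then obtain b where b: "\<And>k x. x \<in> S (own k) \<Longrightarrow> \<bar>x $ k\<bar> \<le> b k"
    by metis
  \<comment> \<open>The absolute value matters: if \<open>S (own k)\<close> is empty,
    \<open>b k\<close> is arbitrary and may be negative.\<close>
  have "norm x \<le> (\<Sum>k\<in>UNIV. \<bar>b k\<bar>)" if x: "x \<in> coalition_box own S c" for x
  proof -
    have "\<bar>x $ k\<bar> \<le> \<bar>b k\<bar>" for k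
    proof (cases "own k \<in> c")
      case True
      then have "restr own {own k} x \<in> S (own k)"
        using x by (simp add: coalition_box_def)
      from b[OF this] show ?thesis
        by (simp add: restr_nth)
    next
      case False
      then show ?thesis
        using x by (simp add: coalition_box_def csub_def)
    qed
    then show ?thesis
      by (intro order_trans[OF norm_le_l1_cart] sum_mono)
  qed
  then have "bounded (coalition_box own S c)"
    unfolding bounded_iff by blast
  moreover have "closed (coalition_box own S c)"
    unfolding coalition_box_alt
    by (intro closed_Int closed_INT ballI closed_subspace csub_subspace closed_vimage
        compact_imp_closed assms linear_continuous_on linear_conv_bounded_linear[THEN iffD1]
        linear_restr)
  ultimately show ?thesis
    by (simp add: compact_eq_bounded_closed)
qed

section \<open>Arithmetic of scaled convex sets\<close>

lemma zero_in_scaled: "0 \<in> S \<Longrightarrow> 0 \<in> scaled a S"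
  by force

lemma scaled_mono:
  assumes "convex S" "0 \<in> S" "0 \<le> a" "a \<le> b"
  shows "scaled a S \<subseteq> scaled b S"
proof
  fix y assume "y \<in> scaled a S"
  then obtain x where x: "x \<in> S" "y = a *\<^sub>R x" by blast
  show "y \<in> scaled b S"
  proof (cases "b = 0")
    case True
    then show ?thesis using x assms by auto
  next
    case False
    then have "(1 - a / b) *\<^sub>R 0 + (a / b) *\<^sub>R x \<in> S"
      using assms x by (intro convexD) auto
    moreover have "y = b *\<^sub>R ((1 - a / b) *\<^sub>R 0 + (a / b) *\<^sub>R x)"
      using x False by simp
    ultimately show ?thesis by blast
  qed
qed

text \<open>Up to the factor \<open>a + b\<close>, the sum is a convex combination with weights
  \<open>a / (a + b)\<close> and \<open>b / (a + b)\<close>; if \<open>a + b = 0\<close>, both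
  summands vanish.\<close>

lemma scaled_add:
  assumes "convex S" "0 \<in> S" "0 \<le> a" "0 \<le> b" "x \<in> scaled a S" "y \<in> scaled b S"
  shows "x + y \<in> scaled (a + b) S"
proof (cases "a + b = 0")
  case True
  then show ?thesis using assms by (auto simp: add_nonneg_eq_0_iff)
next
  case False
  obtain p q where pq: "p \<in> S" "x = a *\<^sub>R p" "q \<in> S" "y = b *\<^sub>R q"
    using assms by blast
  have "(a / (a + b)) *\<^sub>R p + (b / (a + b)) *\<^sub>R q \<in> S"
    using assms pq False by (intro convexD) (auto simp: add_divide_distrib[symmetric])
  moreover have "x + y = (a + b) *\<^sub>R ((a / (a + b)) *\<^sub>R p + (b / (a + b)) *\<^sub>R q)"
    using pq False by (simp add: scaleR_add_right)
  ultimately show ?thesis by blast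
qed

lemma sum_in_set_sum:
  assumes "finite D" "\<And>d. d \<in> D \<Longrightarrow> f d \<in> S d"
  shows "sum f D \<in> sum S D"
  using assms by (induction rule: finite_induct) (auto intro: set_plus_intro)

section \<open>Steering to the origin\<close>

text \<open>Both optimal control problems have feasible sets of this form, the primary one with zero
  disturbance. The zero tail leaves one representative per finite sequence, which makes compactness
  possible.\<close>

definition steering where
  "steering A B X U h w x = {u. (\<forall>j\<ge>h. u j = 0) \<and>
     (\<forall>j<h. traj A B w x u j \<in> X \<and> u j \<in> U) \<and> traj A B w x u h = 0}"

lemma feas1_eq_steering:
  "feas1 P T c = steering (Ac P c c) (Bc P c) (scaled (\<alpha>x T c) (Xc P c)) (scaled (\<alpha>u T c) (Uc P c))
     (N T) (\<lambda>_. 0)"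
  by (simp add: fun_eq_iff feas1_def steering_def)

lemma feas2_eq_steering:
  "feas2 P T c = steering (Ac P c c) (Bc P c) (scaled (\<beta>x T c) (Xc P c)) (scaled (\<beta>u T c) (Uc P c))
     (H T)"
  by (simp add: fun_eq_iff feas2_def steering_def)

lemma traj_shift:
  "traj A B (shift w) (A *v x + B *v u 0 + w 0) (shift u) j = traj A B w x u (Suc j)"
  by (induction j) (simp_all add: shift_def)

lemma shift_in_steering:
  assumes u: "u \<in> steering A B X U h w x" and zero: "0 \<in> X" "0 \<in> U" "w h = 0"
  shows "shift u \<in> steering A B X U h (shift w) (A *v x + B *v u 0 + w 0)"
proof -
  \<comment> \<open>For \<open>Suc j = h\<close> the state is the terminal origin and the input is
    the zero padding, so \<open>0\<close> must satisfy both constraints.\<close>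
  have "traj A B w x u (Suc j) \<in> X \<and> u (Suc j) \<in> U" if "j < h" for j
    using u zero that by (cases "Suc j = h") (auto simp: steering_def simp del: traj.simps)
  \<comment> \<open>The appended step starts at the origin with zero input, so it ends at
    \<open>w h\<close>.\<close>
  moreover have "traj A B w x u (Suc h) = 0"
    using u zero by (simp add: steering_def)
  ultimately show ?thesis
    using u by (simp add: steering_def traj_shift del: traj.simps) (simp add: shift_def)
qed

lemma steering_head:
  assumes "u \<in> steering A B X U h w x" "0 < h"
  shows "x \<in> X" "u 0 \<in> U"
proof -
  have "traj A B w x u 0 \<in> X \<and> u 0 \<in> U"
    using assms unfolding steering_def by blast
  then show "x \<in> X" "u 0 \<in> U" by simp_all
qed

lemma zero_in_steering:
  assumes "0 \<in> X" "0 \<in> U"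
  shows "(\<lambda>_. 0) \<in> steering A B X U h (\<lambda>_. 0) 0"
proof -
  have "traj A B (\<lambda>_. 0) 0 (\<lambda>_. 0) j = 0" for j
    by (induction j) simp_all
  then show ?thesis using assms by (simp add: steering_def)
qed

section \<open>Existence of optimal sequences\<close>

lemma continuous_on_eval: "continuous_on S (\<lambda>u :: nat \<Rightarrow> real ^ 'm. u j)"
  by (rule continuous_on_product_then_coordinatewise) (rule continuous_on_id)

lemma continuous_on_matrix_vector_mult:
  "continuous_on S f \<Longrightarrow> continuous_on S (\<lambda>u. (G :: real ^ 'a ^ 'b) *v f u)"
  by (rule bounded_linear.continuous_on[OF matrix_vector_mul_bounded_linear])

lemma continuous_on_traj: "continuous_on S (\<lambda>u. traj A B w x u j)"
  by (induction j)
     (simp_all add: continuous_on_add continuous_on_const continuous_on_eval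
       continuous_on_matrix_vector_mult)

lemma continuous_on_total_cost:
  "continuous_on S (\<lambda>u. \<Sum>j<h. stage_cost P c (traj A B w x u j) (u j))"
  unfolding stage_cost_def
  by (intro continuous_on_sum continuous_on_add continuous_on_inner continuous_on_traj
      continuous_on_eval continuous_on_matrix_vector_mult)

lemma compact_steering:
  assumes "compact X" "compact U"
  shows "compact (steering A B X U h w x)"
proof -
  \<comment> \<open>Tychonoff makes this product of \<open>U\<close> and singletons compact; the
    trajectory constraints then cut out closed subsets of it.\<close>
  define K where "K = PiE UNIV (\<lambda>j. if j < h then U else {0 :: real ^ 'b})"
  have K_iff: "u \<in> K \<longleftrightarrow> (\<forall>j\<ge>h. u j = 0) \<and> (\<forall>j<h. u j \<in> U)" for u
    unfolding K_def PiE_UNIV_domain Pi_def by simp (metis not_less singletonD singletonI)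
  have "compactin (product_topology (\<lambda>_. euclidean) UNIV) K"
    unfolding K_def compactin_PiE using assms by simp
  then have "compact K"
    by (simp add: euclidean_product_topology)
  moreover have "closed {u. traj A B w x u j \<in> X}" for j
    using closed_vimage[OF compact_imp_closed[OF assms(1)] continuous_on_traj[of UNIV A B w x j]]
    by (simp add: vimage_def)
  moreover have "closed {u. traj A B w x u h = 0}"
    using closed_vimage[OF closed_singleton continuous_on_traj[of UNIV A B w x h], of 0]
    by (simp add: vimage_def)
  ultimately have "compact (K \<inter> ((\<Inter>j\<in>{..<h}. {u. traj A B w x u j \<in> X}) \<inter>
      {u. traj A B w x u h = 0}))"
    by (intro compact_Int_closed closed_Int closed_INT ballI)
  also have "K \<inter> ((\<Inter>j\<in>{..<h}. {u. traj A B w x u j \<in> X}) \<inter> {u. traj A B w x u h = 0})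
      = steering A B X U h w x"
    by (auto simp: K_iff steering_def)
  finally show ?thesis .
qed

text \<open>\<open>arg_min_on\<close> is a choice operator, so its value is known to lie in
  \<open>S\<close> only once a minimizer exists; Weierstrass provides one.\<close>

lemma arg_min_on_compact_in:
  fixes f :: "'a::topological_space \<Rightarrow> real"
  assumes "compact S" "S \<noteq> {}" "continuous_on S f"
  shows "arg_min_on f S \<in> S"
proof -
  obtain x where "x \<in> S" "\<forall>y\<in>S. f x \<le> f y"
    using continuous_attains_inf[OF assms] by blast
  then have "is_arg_min f (\<lambda>x. x \<in> S) x"
    by (simp add: is_arg_min_linorder)
  then have "is_arg_min f (\<lambda>x. x \<in> S) (arg_min_on f S)"
    unfolding arg_min_on_def arg_min_def by (rule someI)
  then show ?thesis
    by (simp add: is_arg_min_def)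
qed

section \<open>Recursive feasibility and constraint satisfaction\<close>

locale coalition_constraints =
  fixes P :: "('s::finite, 'n::finite, 'm::finite) plant"
  assumes compact_Xsub: "compact (Xsub P i)" and convex_Xsub: "convex (Xsub P i)"
    and zero_Xsub: "0 \<in> Xsub P i"
    and compact_Usub: "compact (Usub P i)" and convex_Usub: "convex (Usub P i)"
    and zero_Usub: "0 \<in> Usub P i"
begin

lemma Xc_facts: "compact (Xc P c)" "convex (Xc P c)" "0 \<in> Xc P c"
  unfolding Xc_eq_coalition_box
  by (intro compact_coalition_box convex_coalition_box zero_in_coalition_box
      compact_Xsub convex_Xsub zero_Xsub)+

lemma Uc_facts: "compact (Uc P c)" "convex (Uc P c)" "0 \<in> Uc P c"
  unfolding Uc_eq_coalition_box
  by (intro compact_coalition_box convex_coalition_box zero_in_coalition_box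
      compact_Usub convex_Usub zero_Usub)+

lemma u_opt_feasible: "x \<in> XN P T c \<Longrightarrow> u_opt P T c x \<in> feas1 P T c x"
  unfolding u_opt_def XN_def
  by (rule arg_min_on_compact_in)
     (auto simp: feas1_eq_steering cost1_def[abs_def]
       intro!: compact_steering compact_scaling Xc_facts Uc_facts continuous_on_total_cost)

lemma f_opt_feasible: "e \<in> EH P T c w \<Longrightarrow> f_opt P T c w e \<in> feas2 P T c w e"
  unfolding f_opt_def EH_def
  by (rule arg_min_on_compact_in)
     (auto simp: feas2_eq_steering cost2_def[abs_def]
       intro!: compact_steering compact_scaling Xc_facts Uc_facts continuous_on_total_cost)

lemma XN_step:
  assumes "x \<in> XN P T c"
  shows "Ac P c c *v x + Bc P c *v \<kappa>bar P T c x \<in> XN P T c"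
proof -
  have "shift (\<lambda>_. 0 :: real ^ 'n) = (\<lambda>_. 0)"
    by (simp add: shift_def)
  then have "shift (u_opt P T c x) \<in> feas1 P T c (Ac P c c *v x + Bc P c *v \<kappa>bar P T c x)"
    using shift_in_steering[OF u_opt_feasible[OF assms, unfolded feas1_eq_steering]]
    by (simp add: feas1_eq_steering \<kappa>bar_def zero_in_scaled Xc_facts Uc_facts)
  then show ?thesis
    by (auto simp: XN_def)
qed

text \<open>Vanishing at the single index \<open>H T\<close> is what the appended step consumes; it
  covers the sequences in \<open>WN\<close> as well as those kept along a run.\<close>

lemma EH_step:
  assumes "e \<in> EH P T c w" "w (H T) = 0"
  shows "Ac P c c *v e + Bc P c *v \<kappa>hat P T c w e + w 0 \<in> EH P T c (shift w)"
proof -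
  have "shift (f_opt P T c w e)
      \<in> feas2 P T c (shift w) (Ac P c c *v e + Bc P c *v \<kappa>hat P T c w e + w 0)"
    using shift_in_steering[OF f_opt_feasible[OF assms(1), unfolded feas2_eq_steering]] assms(2)
    by (simp add: feas2_eq_steering \<kappa>hat_def zero_in_scaled Xc_facts Uc_facts)
  then show ?thesis
    by (auto simp: EH_def)
qed

lemma zero_in_EH: "0 \<in> EH P T c (\<lambda>_. 0)"
proof -
  have "(\<lambda>_. 0) \<in> feas2 P T c (\<lambda>_. 0) 0"
    unfolding feas2_eq_steering by (intro zero_in_steering zero_in_scaled Xc_facts Uc_facts)
  then show ?thesis
    by (auto simp: EH_def)
qed

lemma XN_scaled:
  assumes "x \<in> XN P T c" "0 < N T"
  shows "x \<in> scaled (\<alpha>x T c) (Xc P c)" "\<kappa>bar P T c x \<in> scaled (\<alpha>u T c) (Uc P c)"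
  using steering_head[OF u_opt_feasible[OF assms(1), unfolded feas1_eq_steering] assms(2)]
  by (simp_all add: \<kappa>bar_def)

lemma EH_scaled:
  assumes "e \<in> EH P T c w" "0 < H T"
  shows "e \<in> scaled (\<beta>x T c) (Xc P c)" "\<kappa>hat P T c w e \<in> scaled (\<beta>u T c) (Uc P c)"
  using steering_head[OF f_opt_feasible[OF assms(1), unfolded feas2_eq_steering] assms(2)]
  by (simp_all add: \<kappa>hat_def)

end

text \<open>By linearity the scaling may be moved from the neighbour's state to its image under
  \<open>Ac P c d\<close>.\<close>

lemma coupling_set_memI:
  assumes "\<And>d. d \<in> nbrs P C c \<Longrightarrow> v d \<in> scaled (a d) (Xc P d)"
  shows "(\<Sum>d\<in>nbrs P C c. Ac P c d *v v d)
    \<in> coupling_set P C a (c :: 's::finite set)"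
  unfolding coupling_set_def
proof (rule sum_in_set_sum)
  fix d assume "d \<in> nbrs P C c"
  then obtain y where "y \<in> Xc P d" "v d = a d *\<^sub>R y"
    using assms by blast
  then show "Ac P c d *v v d \<in> scaled (a d) ((*v) (Ac P c d) ` Xc P d)"
    by (auto simp: matrix_vector_mult_scaleR)
qed simp

section \<open>Invariant of the closed loop\<close>

locale tuned_coalitions = coalition_constraints P
  for P :: "('s::finite, 'n::finite, 'm::finite) plant" +
  fixes T :: "'s tuning"
    and C :: "'s set set"
    and \<xi>x \<xi>u :: "'s set \<Rightarrow> real"
    and \<kappa>t :: "'s set \<Rightarrow> real ^ 'n \<Rightarrow> real ^ 'm"
    and \<R> :: "'s set \<Rightarrow> (real ^ 'n) set"
  assumes horizons: "0 < N T" "N T < H T"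
    and nonneg: "c \<in> C \<Longrightarrow> 0 \<le> \<alpha>x T c" "c \<in> C \<Longrightarrow> 0 \<le> \<alpha>u T c" "c \<in> C \<Longrightarrow> 0 \<le> \<beta>x T c"
      "c \<in> C \<Longrightarrow> 0 \<le> \<beta>u T c" "c \<in> C \<Longrightarrow> 0 \<le> \<xi>x c" "c \<in> C \<Longrightarrow> 0 \<le> \<xi>u c"
    and R_subset: "c \<in> C \<Longrightarrow> \<R> c \<subseteq> scaled (\<xi>x c) (Xc P c)"
    and R_inducing: "c \<in> C \<Longrightarrow>
      invariance_inducing (\<lambda>e f w. Ac P c c *v e + Bc P c *v f + w)
        (scaled (\<xi>u c) (Uc P c)) (What P T C c) (\<kappa>t c) (\<R> c)"
    and scaling: "c \<in> C \<Longrightarrow> \<alpha>x T c + \<beta>x T c + \<xi>x c \<le> 1"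
      "c \<in> C \<Longrightarrow> \<alpha>u T c + \<beta>u T c + \<xi>u c \<le> 1"
begin

text \<open>The condition on the tail of \<open>wb\<close> is stable under \<open>shift\<close> and
  supplies the premise of \<open>EH_step\<close>.\<close>

definition coalition_inv :: "('s set \<Rightarrow> 'n cstate) \<Rightarrow> 's set \<Rightarrow> bool" where
  "coalition_inv s c \<longleftrightarrow> xb (s c) \<in> XN P T c \<and> eb (s c) \<in> EH P T c (wb (s c)) \<and>
     (\<forall>j\<ge>H T. wb (s c) j = 0) \<and> e_hat s c \<in> \<R> c"

text \<open>The deviation is \<open>eb + e_hat\<close>. The bound serves the coalition's own state
  constraint and the disturbance seen by its neighbours.\<close>

lemma deviation_scaled:
  assumes "c \<in> C" "coalition_inv s c"
  shows "px (s c) - xb (s c) \<in> scaled (\<beta>x T c + \<xi>x c) (Xc P c)"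
proof -
  have "eb (s c) \<in> scaled (\<beta>x T c) (Xc P c)" "e_hat s c \<in> scaled (\<xi>x c) (Xc P c)"
    using assms R_subset horizons EH_scaled(1) by (fastforce simp: coalition_inv_def)+
  from scaled_add[OF Xc_facts(2,3) nonneg(3,5) this] show ?thesis
    using assms(1) by (simp add: e_hat_def)
qed

text \<open>Feasibility is part of the acceptance test for a new sequence and part of the invariant
  for a retained one. A new sequence vanishes beyond \<open>N T\<close>, hence from
  \<open>H T\<close> on.\<close>

lemma w_used_feasible:
  assumes "coalition_inv s c"
  shows "eb (s c) \<in> EH P T c (w_used P T C s c)" "\<forall>j\<ge>H T. w_used P T C s c j = 0"
  using assms horizons by (auto simp: w_used_def accepts_def w_new_def coalition_inv_def)

lemma state_constraint:
  assumes c: "c \<in> C" and inv: "coalition_inv s c"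
  shows "px (s c) \<in> Xc P c"
proof -
  have "xb (s c) \<in> scaled (\<alpha>x T c) (Xc P c)"
    using inv horizons XN_scaled(1) by (simp add: coalition_inv_def)
  from scaled_add[OF Xc_facts(2,3) _ _ this deviation_scaled[OF c inv]]
  have "px (s c) \<in> scaled (\<alpha>x T c + (\<beta>x T c + \<xi>x c)) (Xc P c)"
    using nonneg c by simp
  also have "\<dots> \<subseteq> scaled 1 (Xc P c)"
    using nonneg scaling c by (intro scaled_mono Xc_facts) (simp_all add: add.assoc)
  finally show ?thesis by simp
qed

lemma input_constraint:
  assumes c: "c \<in> C" and inv: "coalition_inv s c"
  shows "u_applied P T C \<kappa>t s c \<in> Uc P c"
proof -
  have "\<kappa>bar P T c (xb (s c)) \<in> scaled (\<alpha>u T c) (Uc P c)"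
    using inv horizons XN_scaled(2) by (simp add: coalition_inv_def)
  moreover have "\<kappa>hat P T c (w_used P T C s c) (eb (s c)) \<in> scaled (\<beta>u T c) (Uc P c)"
    using w_used_feasible(1)[OF inv] horizons EH_scaled(2) by simp
  moreover have "\<kappa>t c (e_hat s c) \<in> scaled (\<xi>u c) (Uc P c)"
    using inv R_inducing[OF c] by (simp add: coalition_inv_def invariance_inducing_def)
  ultimately have "u_applied P T C \<kappa>t s c \<in> scaled (\<alpha>u T c + \<beta>u T c + \<xi>u c) (Uc P c)"
    unfolding u_applied_def using nonneg c by (intro scaled_add Uc_facts) simp_all
  also have "\<dots> \<subseteq> scaled 1 (Uc P c)"
    using nonneg scaling c by (intro scaled_mono Uc_facts) simp_all
  finally show ?thesis by simp
qed

lemma mismatch_in_What: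
  assumes inv: "\<forall>d\<in>C. coalition_inv s d" and "accepts P T C s c"
  shows "w_actual P C s c - w_used P T C s c 0 \<in> What P T C c"
proof -
  \<comment> \<open>An optimal trajectory starts at the current nominal state, so the accepted
    sequence begins with the coupling of the \<open>xb (s d)\<close>.\<close>
  have "w_actual P C s c - w_used P T C s c 0
      = (\<Sum>d\<in>nbrs P C c. Ac P c d *v (px (s d) - xb (s d)))"
    using assms(2)
    by (simp add: w_actual_def w_used_def w_new_def x_opt_def sum_subtractf
        matrix_vector_mult_diff_distrib)
  also have "\<dots> \<in> What P T C c"
    unfolding What_def
  proof (rule coupling_set_memI)
    fix d assume "d \<in> nbrs P C c"
    then have d: "d \<in> C" by (simp add: nbrs_def)
    then have "px (s d) - xb (s d) \<in> scaled (\<beta>x T d + \<xi>x d) (Xc P d)"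
      using deviation_scaled inv by blast
    \<comment> \<open>This is where the scaling condition of the neighbour, \<alpha> + \<beta> +
      \<xi> \<le> 1, is used.\<close>
    also have "\<dots> \<subseteq> scaled (1 - \<alpha>x T d) (Xc P d)"
      using nonneg[OF d] scaling[OF d] by (intro scaled_mono Xc_facts) simp_all
    finally show "px (s d) - xb (s d) \<in> scaled (1 - \<alpha>x T d) (Xc P d)" .
  qed
  finally show ?thesis .
qed

lemma coalition_inv_step:
  assumes c: "c \<in> C" and inv: "coalition_inv s c"
    and mismatch: "w_actual P C s c - w_used P T C s c 0 \<in> What P T C c"
  shows "coalition_inv (mpc_step P T C \<kappa>t s) c"
proof -
  \<comment> \<open>The nominal and planned inputs cancel, leaving the residual dynamics with the
    mismatch as disturbance.\<close>
  have "e_hat (mpc_step P T C \<kappa>t s) c = Ac P c c *v e_hat s c + Bc P c *v \<kappa>t c (e_hat s c)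
      + (w_actual P C s c - w_used P T C s c 0)"
    by (simp add: e_hat_def mpc_step_def u_applied_def matrix_vector_mult_diff_distrib
        matrix_vector_right_distrib)
  moreover have "\<dots> \<in> \<R> c"
    using inv mismatch R_inducing[OF c] by (auto simp: coalition_inv_def invariance_inducing_def)
  ultimately show ?thesis
    using inv XN_step[of "xb (s c)" T c] w_used_feasible[OF inv]
      EH_step[of "eb (s c)" T c "w_used P T C s c"]
    by (auto simp: coalition_inv_def mpc_step_def shift_def[abs_def])
qed

text \<open>The induction treats all coalitions together, since the mismatch of one is bounded
  through the invariants of its neighbours. The residual error starts at zero, hence
  \<open>0 \<in> \<R> c\<close>.\<close>

lemma coalition_inv_run:
  assumes "\<forall>c\<in>C. restr (st_of P) c x0 \<in> XN P T c" "\<forall>c\<in>C. 0 \<in> \<R> c"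
    and "retained_plans_consistent P T C \<kappa>t x0"
  shows "\<forall>c\<in>C. coalition_inv (mpc_run P T C \<kappa>t x0 k) c"
proof (induction k)
  case 0
  show ?case
    using assms(1,2) zero_in_EH by (simp add: coalition_inv_def mpc_init_def e_hat_def)
next
  case (Suc k)
  have "w_actual P C (mpc_run P T C \<kappa>t x0 k) c - w_used P T C (mpc_run P T C \<kappa>t x0 k) c 0
      \<in> What P T C c" if "c \<in> C" for c
  proof (cases "accepts P T C (mpc_run P T C \<kappa>t x0 k) c")
    case True
    then show ?thesis using mismatch_in_What Suc by blast
  next
    \<comment> \<open>The retained sequence carries no information on the current coupling; the
      bound is exactly \<open>retained_plans_consistent\<close>.\<close>
    case False
    then show ?thesis
      using assms(3) that by (simp add: retained_plans_consistent_def w_used_def)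
  qed
  then show ?case
    using Suc coalition_inv_step by simp
qed

end

theorem proposition3p1:
  fixes P :: "('s::finite, 'n::finite, 'm::finite) plant"
    and T :: "'s tuning"
    and C :: "'s set set"
    and \<xi>x \<xi>u :: "'s set \<Rightarrow> real"
    and \<kappa>t :: "'s set \<Rightarrow> real ^ 'n \<Rightarrow> real ^ 'm"
    and \<R> :: "'s set \<Rightarrow> (real ^ 'n) set"
  assumes wf: "wf_plant P"
    and partition: "partition_on UNIV C"
    and horizons: "1 \<le> N T" "N T + 1 \<le> H T"
    and ctrl_sub: "\<And>i. controllable (xspace P {i}) (uspace P {i}) (Ablk P i i) (Bblk P i)"
    and X_sets: "\<And>i. compact (Xsub P i) \<and> convex (Xsub P i) \<and>
                     0 \<in> (top_of_set (xspace P {i})) interior_of (Xsub P i)"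
    and U_sets: "\<And>i. compact (Usub P i) \<and> convex (Usub P i) \<and>
                     0 \<in> (top_of_set (uspace P {i})) interior_of (Usub P i)"
    and ctrl_coal: "\<And>D c. partition_on UNIV D \<Longrightarrow> c \<in> D \<Longrightarrow>
                     controllable (xspace P c) (uspace P c) (Ac P c c) (Bc P c)"
    and costs: "\<And>i. posdef_on (xspace P {i}) (Qsub P i)"
               "\<And>i. posdef_on (uspace P {i}) (Rsub P i)"
    and alpha: "\<And>c. c \<in> C \<Longrightarrow> 0 < \<alpha>x T c \<and> \<alpha>x T c < 1 \<and> 0 < \<alpha>u T c \<and> \<alpha>u T c < 1"
    and beta: "\<And>c. c \<in> C \<Longrightarrow> 0 \<le> \<beta>x T c \<and> 0 \<le> \<beta>u T c"
    and xi: "\<And>c. c \<in> C \<Longrightarrow> 0 \<le> \<xi>x c \<and> \<xi>x c < 1 \<and> 0 \<le> \<xi>u c \<and> \<xi>u c < 1"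
    and R_rci: "\<And>c. c \<in> C \<Longrightarrow>
                  rci (\<lambda>e f w. Ac P c c *v e + Bc P c *v f + w)
                    (scaled (\<xi>x c) (Xc P c)) (scaled (\<xi>u c) (Uc P c)) (What P T C c) (\<R> c)"
    and R_inducing: "\<And>c. c \<in> C \<Longrightarrow>
                  invariance_inducing (\<lambda>e f w. Ac P c c *v e + Bc P c *v f + w)
                    (scaled (\<xi>u c) (Uc P c)) (What P T C c) (\<kappa>t c) (\<R> c)"
    and scaling: "\<And>c. c \<in> C \<Longrightarrow> \<alpha>x T c + \<beta>x T c + \<xi>x c \<le> 1"
                 "\<And>c. c \<in> C \<Longrightarrow> \<alpha>u T c + \<beta>u T c + \<xi>u c \<le> 1"
  shows "(\<forall>c\<in>C. \<forall>x\<in>XN P T c. Ac P c c *v x + Bc P c *v \<kappa>bar P T c x \<in> XN P T c) \<and>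
    (\<forall>c\<in>C. \<forall>w\<in>WN P T C c. \<forall>e\<in>EH P T c w.
        Ac P c c *v e + Bc P c *v \<kappa>hat P T c w e + w 0 \<in> EH P T c (shift w)) \<and>
    (\<forall>x0. (\<forall>c\<in>C. restr (st_of P) c x0 \<in> XN P T c) \<and> (\<forall>c\<in>C. 0 \<in> \<R> c) \<and>
          retained_plans_consistent P T C \<kappa>t x0 \<longrightarrow>
        (\<forall>c\<in>C. \<forall>k. px (mpc_run P T C \<kappa>t x0 k c) \<in> Xc P c \<and>
                     u_applied P T C \<kappa>t (mpc_run P T C \<kappa>t x0 k) c \<in> Uc P c))"
proof -
  \<comment> \<open>Interiors are relative to the coordinate subspaces and are contained in the sets
    themselves.\<close>
  have "0 \<in> Xsub P i" "0 \<in> Usub P i" for i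
    using X_sets[of i] U_sets[of i] by (meson interior_of_subset subsetD)+
  then interpret coalition_constraints P
    by unfold_locales (use X_sets U_sets in blast)+
  have "0 \<le> \<alpha>x T c" "0 \<le> \<alpha>u T c" if "c \<in> C" for c
    using alpha[OF that] by simp_all
  moreover have "\<R> c \<subseteq> scaled (\<xi>x c) (Xc P c)" if "c \<in> C" for c
    using R_rci[OF that] by (simp add: rci_def)
  ultimately interpret tuned_coalitions P T C \<xi>x \<xi>u \<kappa>t \<R>
    by unfold_locales (use horizons beta xi in \<open>simp_all add: R_inducing scaling\<close>)
  have dies_out: "w (H T) = 0" if "w \<in> WN P T C c" for w c
    using that horizons by (simp add: WN_def)
  show ?thesis
  proof (intro conjI ballI allI impI; (elim conjE)?)
    fix c x assume "x \<in> XN P T c"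
    then show "Ac P c c *v x + Bc P c *v \<kappa>bar P T c x \<in> XN P T c"
      by (rule XN_step)
  next
    fix c w e assume "w \<in> WN P T C c" "e \<in> EH P T c w"
    then show "Ac P c c *v e + Bc P c *v \<kappa>hat P T c w e + w 0 \<in> EH P T c (shift w)"
      by (intro EH_step dies_out)
  next
    fix x0 c k
    assume c: "c \<in> C" and "\<forall>c\<in>C. restr (st_of P) c x0 \<in> XN P T c" "\<forall>c\<in>C. 0 \<in> \<R> c"
      "retained_plans_consistent P T C \<kappa>t x0"
    then have inv: "coalition_inv (mpc_run P T C \<kappa>t x0 k) c"
      using coalition_inv_run by simp
    show "px (mpc_run P T C \<kappa>t x0 k c) \<in> Xc P c"
      by (rule state_constraint[OF c inv])
    show "u_applied P T C \<kappa>t (mpc_run P T C \<kappa>t x0 k) c \<in> Uc P c"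
      by (rule input_constraint[OF c inv])
  qed
qed

end
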